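(* Let $X$ be a ball quasi-Banach function space on $\mathbb R^n$ satisfying condition (FS) below for some $p_-\in(0,\infty)$; put $\underline p:=\min\{p_-,1\}$. Assume that for any $r\in(0,\underline p)$, $X^{1/r}$ is a ball Banach function space, and that there exist $r_0\in(0,\underline p)$ and $p_0\in(r_0,\infty)$ such that $\|\mathcal M^{((p_0/r_0)')}(f)\|_{(X^{1/r_0})'}\le C\|f\|_{(X^{1/r_0})'}$ for all $f\in(X^{1/r_0})'$. Let $q\in(\max\{1,p_0\},p_0/r_0]$ and $r\in(0,1)$. Then there exists a positive constant $C$ such that, for any $\alpha\in[1,\infty)$ and $f\in WT^1_X(\mathbb R^{n+1}_+)$, $$\|\mathcal A^{(\alpha)}(f)\|_{WX}\le C\Big[\max\Big\{\alpha^{(\frac12-\frac1q)n},1\Big\}\Big]^{q/p_0}\alpha^{\frac{n}{r_0r}}\|\mathcal A^{(1)}(f)\|_{WX}.$$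
   Context: A ball quasi-Banach function space is a quasi-Banach space $X$ of measurable functions on $\mathbb R^n$ such that: $\|f\|_X=0$ implies $f=0$ a.e.; $|g|\le|f|$ a.e. implies $\|g\|_X\le\|f\|_X$; $0\le f_m\uparrow f$ a.e. implies $\|f_m\|_X\uparrow\|f\|_X$; and $\mathbf 1_B\in X$ for every ball $B$. It is a ball Banach function space if moreover $\|\cdot\|_X$ satisfies the triangle inequality and for every ball $B$ there is $C_B$ with $\int_B|f|\le C_B\|f\|_X$. For a ball Banach function space $Y$, $Y'$ is its associate space: measurable $f$ with $\|f\|_{Y'}:=\sup\{\|fg\|_{L^1}:\|g\|_Y=1\}<\infty$. $X^p:=\{f:|f|^p\in X\}$, $\|f\|_{X^p}:=\||f|^p\|_X^{1/p}$. $WX$: measurable $f$ with $\|f\|_{WX}:=\sup_{\alpha>0}\alpha\|\mathbf 1_{\{|f|>\alpha\}}\|_X<\infty$. $\mathcal M$ is the Hardy--Littlewood maximal operator over balls, $\mathcal M^{(\theta)}(f):=[\mathcal M(|f|^\theta)]^{1/\theta}$, $(p_0/r_0)'$ the conjugate exponent. Condition (FS) for $p_-$: for all $p\in(0,p_-)$, $s\in(1,\infty)$, $\|\{\sum_j[\mathcal M(f_j)]^s\}^{1/s}\|_{X^{1/p}}\le C\|\{\sum_j|f_j|^s\}^{1/s}\|_{X^{1/p}}$. $\mathbb R^{n+1}_+:=\mathbb R^n\times(0,\infty)$; for $\alpha>0$, $\Gamma_\alpha(x):=\{(y,t):|x-y|<\alpha t\}$ and $\mathcal A^{(\alpha)}(F)(x):=[\int_{\Gamma_\alpha(x)}|F(y,t)|^2\frac{dy\,dt}{t^{n+1}}]^{1/2}$.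 $WT^1_X(\mathbb R^{n+1}_+)$ is the set of measurable $F$ on $\mathbb R^{n+1}_+$ with $\|\mathcal A^{(1)}(F)\|_{WX}<\infty$. *)

theory Defs
  imports "HOL-Analysis.Analysis"
begin

text \<open>Conventions. A (quasi-)norm on measurable functions on R^n (the type 'a) is encoded
as a functional rho on nonnegative extended-real valued functions; the norm of a real
function f is rho applied to the modulus of f. Value infinity means "not in the space".\<close>

definition epowr :: "ennreal \<Rightarrow> real \<Rightarrow> ennreal" where
  "epowr x p = (if x = \<infinity> then \<infinity> else ennreal (enn2real x powr p))"

definition fmod :: "('a \<Rightarrow> real) \<Rightarrow> 'a \<Rightarrow> ennreal" where
  "fmod f = (\<lambda>x. ennreal \<bar>f x\<bar>)"

definition ball_quasi_banach_function_space ::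
  "(('a::euclidean_space \<Rightarrow> ennreal) \<Rightarrow> ennreal) \<Rightarrow> bool" where
  "ball_quasi_banach_function_space X \<longleftrightarrow>
     \<comment> \<open>norm zero implies zero a.e.\<close>
     (\<forall>F. F \<in> borel_measurable lebesgue \<longrightarrow> X F = 0 \<longrightarrow> (AE x in lebesgue. F x = 0))
   \<and> \<comment> \<open>lattice property\<close>
     (\<forall>F G. F \<in> borel_measurable lebesgue \<longrightarrow> G \<in> borel_measurable lebesgue \<longrightarrow>
        (AE x in lebesgue. G x \<le> F x) \<longrightarrow> X G \<le> X F)
   \<and> \<comment> \<open>Fatou property\<close>
     (\<forall>Fs F. (\<forall>m. Fs m \<in> borel_measurable lebesgue) \<longrightarrow> F \<in> borel_measurable lebesgue \<longrightarrow>
        (AE x in lebesgue. incseq (\<lambda>m. Fs m x) \<and> (\<lambda>m. Fs m x) \<longlonglongrightarrow> F x) \<longrightarrow>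
        (\<lambda>m. X (Fs m)) \<longlonglongrightarrow> X F)
   \<and> \<comment> \<open>indicators of balls belong to X\<close>
     (\<forall>c r. X (indicator (ball c r)) < \<infinity>)
   \<and> \<comment> \<open>homogeneity\<close>
     (\<forall>f c. f \<in> borel_measurable lebesgue \<longrightarrow>
        X (fmod (\<lambda>x. c * f x)) = ennreal \<bar>c\<bar> * X (fmod f))
   \<and> \<comment> \<open>quasi-triangle inequality\<close>
     (\<exists>K::real. K \<ge> 1 \<and> (\<forall>f g. f \<in> borel_measurable lebesgue \<longrightarrow> g \<in> borel_measurable lebesgue \<longrightarrow>
        X (fmod (\<lambda>x. f x + g x)) \<le> ennreal K * (X (fmod f) + X (fmod g))))
   \<and> \<comment> \<open>completeness\<close>
     (\<forall>fs. (\<forall>k. fs k \<in> borel_measurable lebesgue \<and> X (fmod (fs k)) < \<infinity>) \<longrightarrow>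
        (\<forall>e>0. \<exists>N. \<forall>m\<ge>N. \<forall>k\<ge>N. X (fmod (\<lambda>x. fs m x - fs k x)) < e) \<longrightarrow>
        (\<exists>f. f \<in> borel_measurable lebesgue \<and> X (fmod f) < \<infinity> \<and>
             (\<lambda>k. X (fmod (\<lambda>x. fs k x - f x))) \<longlonglongrightarrow> 0))"

definition ball_banach_function_space ::
  "(('a::euclidean_space \<Rightarrow> ennreal) \<Rightarrow> ennreal) \<Rightarrow> bool" where
  "ball_banach_function_space X \<longleftrightarrow>
     ball_quasi_banach_function_space X
   \<and> (\<forall>f g. f \<in> borel_measurable lebesgue \<longrightarrow> g \<in> borel_measurable lebesgue \<longrightarrow>
        X (fmod (\<lambda>x. f x + g x)) \<le> X (fmod f) + X (fmod g))
   \<and> (\<forall>c r. \<exists>C::real. \<forall>F. F \<in> borel_measurable lebesgue \<longrightarrow>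
        (\<integral>\<^sup>+ x\<in>ball c r. F x \<partial>lebesgue) \<le> ennreal C * X F)"

definition Xpow :: "(('a \<Rightarrow> ennreal) \<Rightarrow> ennreal) \<Rightarrow> real \<Rightarrow> ('a \<Rightarrow> ennreal) \<Rightarrow> ennreal" where
  "Xpow X p F = epowr (X (\<lambda>x. epowr (F x) p)) (1 / p)"

definition assoc :: "(('a::euclidean_space \<Rightarrow> ennreal) \<Rightarrow> ennreal) \<Rightarrow> ('a \<Rightarrow> ennreal) \<Rightarrow> ennreal" where
  "assoc Y F = (SUP G \<in> {G. G \<in> borel_measurable lebesgue \<and> Y G = 1}.
                  \<integral>\<^sup>+ x. F x * G x \<partial>lebesgue)"

definition weakX :: "(('a \<Rightarrow> ennreal) \<Rightarrow> ennreal) \<Rightarrow> ('a \<Rightarrow> ennreal) \<Rightarrow> ennreal" where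
  "weakX X F = (SUP a \<in> {0<..}. ennreal a * X (indicator {x. F x > ennreal a}))"

definition HLmax :: "('a::euclidean_space \<Rightarrow> ennreal) \<Rightarrow> 'a \<Rightarrow> ennreal" where
  "HLmax F x = (SUP cr \<in> {(c, r). r > 0 \<and> x \<in> ball c r}.
     (\<integral>\<^sup>+ y\<in>ball (fst cr) (snd cr). F y \<partial>lebesgue) / emeasure lebesgue (ball (fst cr) (snd cr)))"

definition HLmax_pow :: "real \<Rightarrow> ('a::euclidean_space \<Rightarrow> ennreal) \<Rightarrow> 'a \<Rightarrow> ennreal" where
  "HLmax_pow \<theta> F = (\<lambda>x. epowr (HLmax (\<lambda>y. epowr (F y) \<theta>) x) (1 / \<theta>))"

definition FS_condition :: "(('a::euclidean_space \<Rightarrow> ennreal) \<Rightarrow> ennreal) \<Rightarrow> real \<Rightarrow> bool" where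
  "FS_condition X pm \<longleftrightarrow>
     (\<forall>p s. 0 < p \<and> p < pm \<and> 1 < s \<longrightarrow> (\<exists>C::real. \<forall>fs::nat \<Rightarrow> 'a \<Rightarrow> ennreal.
        (\<forall>j. fs j \<in> borel_measurable lebesgue) \<longrightarrow>
        Xpow X (1 / p) (\<lambda>x. epowr (\<Sum>j. epowr (HLmax (fs j) x) s) (1 / s))
          \<le> ennreal C * Xpow X (1 / p) (\<lambda>x. epowr (\<Sum>j. epowr (fs j x) s) (1 / s))))"

definition conical_A :: "real \<Rightarrow> ('a::euclidean_space \<times> real \<Rightarrow> real) \<Rightarrow> 'a \<Rightarrow> ennreal" where
  "conical_A \<alpha> F x = epowr (\<integral>\<^sup>+ z\<in>{z. snd z > 0 \<and> dist x (fst z) < \<alpha> * snd z}.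
       ennreal ((F z)\<^sup>2 / (snd z) ^ (DIM('a) + 1)) \<partial>lebesgue) (1 / 2)"

definition conj_exp :: "real \<Rightarrow> real" where
  "conj_exp p = p / (p - 1)"

end

theory Submission
  imports Defs "HOL-Library.Nat_Bijection"
begin

text \<open>
  Cut the upper half-space into dyadic slices and let u_j(x) be the mass that |F|^2 dy dt / t^(n+1)
  gives to the part of the unit cone at x in the j-th slice, so that A^(1)(F)^2 is the sum of the
  u_j. A cone of aperture a is covered, slice by slice, by about a^n unit-cone pieces, which for
  0 < s \<le> 1 gives the pointwise bound
  A^(a)(F)^2 \<le> (30 a)^(n/s) * sum_j M(u_j^s)^(1/s).
  With s = r0 r / 2 the power of a is the claimed one, and it remains to bound the square root of the
  right-hand sum from WX to WX. Splitting every u_j at the level set A^(1)(F) > l, the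
  Fefferman--Stein condition is applied to the r-th power of the upper part (p = r0) and to the
  square of the lower part (p = r0 r / 2); summing over geometric levels gives the weak bound.
  The factor with exponent q / p0 is at least 1.
\<close>

section \<open>Powers and the maximal function\<close>

lemma epowr_top [simp]: "epowr top p = top"
  by (simp add: epowr_def)

lemma epowr_ennreal: "0 \<le> x \<Longrightarrow> epowr (ennreal x) p = ennreal (x powr p)"
  by (simp add: epowr_def)

lemma epowr_0 [simp]: "epowr 0 p = 0"
  by (simp add: epowr_def)

lemma epowr_one [simp]: "epowr x 1 = x"
  by (cases x) (auto simp: epowr_ennreal)

lemma epowr_mono: "0 \<le> p \<Longrightarrow> x \<le> y \<Longrightarrow> epowr x p \<le> epowr y p"
  by (cases x; cases y) (auto simp: epowr_ennreal top_unique intro!: powr_mono2 ennreal_leI)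

lemma epowr_epowr: "epowr (epowr x p) q = epowr x (p * q)"
  by (cases x) (auto simp: epowr_ennreal powr_powr)

lemma epowr_mult: "0 < p \<Longrightarrow> epowr (x * y) p = epowr x p * epowr y p"
proof (cases x; cases y)
  fix a b assume "0 \<le> a" "x = ennreal a" "0 \<le> b" "y = ennreal b"
  then show "epowr (x * y) p = epowr x p * epowr y p"
    by (simp add: epowr_ennreal powr_mult flip: ennreal_mult)
qed (auto simp: epowr_ennreal ennreal_top_mult ennreal_mult_top)

lemma epowr_indicator: "epowr (x * indicator A z) p = epowr x p * indicator A z"
  by (simp split: split_indicator)

text \<open>Dividing by \<open>a + b\<close> reduces the claim to numbers in [0,1], where lowering
  the exponent from 1 to \<open>p\<close> can only increase a power.\<close>

lemma epowr_add_le: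
  assumes "0 < p" "p \<le> 1"
  shows "epowr (x + y) p \<le> epowr x p + epowr y p"
proof (cases x; cases y)
  fix a b assume ab: "0 \<le> a" "x = ennreal a" "0 \<le> b" "y = ennreal b"
  have "(a + b) powr p \<le> a powr p + b powr p"
  proof (cases "a + b = 0")
    case False
    then have "a / (a + b) \<le> (a / (a + b)) powr p" "b / (a + b) \<le> (b / (a + b)) powr p"
      using assms ab powr_mono'[of p 1 "a / (a + b)"] powr_mono'[of p 1 "b / (a + b)"] by auto
    moreover have "a / (a + b) + b / (a + b) = 1"
      using False by (simp flip: add_divide_distrib)
    ultimately have "1 \<le> (a powr p + b powr p) / (a + b) powr p"
      using ab by (simp add: powr_divide add_divide_distrib)
    then show ?thesis
      using ab False by (simp add: field_simps)
  qed (use ab in auto)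
  then show ?thesis
    using ab by (simp add: epowr_ennreal flip: ennreal_plus)
qed auto

lemma epowr_sum_le:
  assumes "0 < p" "p \<le> 1"
  shows "epowr (\<Sum>i\<in>I. f i) p \<le> (\<Sum>i\<in>I. epowr (f i) p)"
proof (induction I rule: infinite_finite_induct)
  case (insert i I)
  have "epowr (f i + sum f I) p \<le> epowr (f i) p + epowr (sum f I) p"
    by (rule epowr_add_le[OF assms])
  also have "\<dots> \<le> epowr (f i) p + (\<Sum>i\<in>I. epowr (f i) p)"
    by (intro add_left_mono insert.IH)
  finally show ?case
    using insert by simp
qed auto

text \<open>Serves the exponent \<open>1 / s\<close> above 1, where subadditivity fails; the bound
  \<open>x + y \<le> 2 * max x y\<close> costs only a constant.\<close>

lemma epowr_add_le_two_powr:
  assumes "0 < p"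
  shows "epowr (x + y) p \<le> ennreal (2 powr p) * (epowr x p + epowr y p)"
proof -
  have "epowr (x + y) p \<le> epowr (2 * max x y) p"
    using assms by (intro epowr_mono) (auto simp: mult_2 intro: add_mono)
  also have "\<dots> = ennreal (2 powr p) * epowr (max x y) p"
    using assms epowr_ennreal[of 2 p] by (simp add: epowr_mult)
  also have "\<dots> \<le> ennreal (2 powr p) * (epowr x p + epowr y p)"
    by (intro mult_left_mono) (auto simp: max_def)
  finally show ?thesis .
qed

lemma borel_measurable_epowr [measurable]:
  assumes [measurable]: "f \<in> borel_measurable M"
  shows "(\<lambda>x. epowr (f x) p) \<in> borel_measurable M"
  unfolding epowr_def by measurable

text \<open>Lower semicontinuity gives measurability. This covers both the maximal function and the
  mass of a cone as a function of its vertex.\<close>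

lemma borel_measurable_open_superlevel:
  fixes f :: "'a::euclidean_space \<Rightarrow> ennreal"
  assumes "\<And>c. open {x. c < f x}"
  shows "f \<in> borel_measurable lebesgue"
proof (rule borel_measurableI_greater)
  fix c
  have "{x. c < f x} \<in> sets lborel"
    using assms by simp
  then show "{x \<in> space lebesgue. c < f x} \<in> sets lebesgue"
    by simp
qed

lemma superlevel_sets_lebesgue:
  fixes f :: "'a::euclidean_space \<Rightarrow> ennreal"
  assumes [measurable]: "f \<in> borel_measurable lebesgue"
  shows "{x. f x > c} \<in> sets lebesgue"
proof -
  have "{x \<in> space lebesgue. f x > c} \<in> sets lebesgue"
    by measurable
  then show ?thesis
    by simp
qed

lemma HLmax_ge:
  fixes F :: "'a::euclidean_space \<Rightarrow> ennreal"
  assumes "0 < r" "x \<in> ball c r"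
  shows "(\<integral>\<^sup>+ y\<in>ball c r. F y \<partial>lebesgue) \<le> emeasure lebesgue (ball c r) * HLmax F x"
proof -
  let ?m = "emeasure lebesgue (ball c r)" and ?I = "\<integral>\<^sup>+ y\<in>ball c r. F y \<partial>lebesgue"
  \<comment> \<open>Cancelling a divisor in \<open>ennreal\<close> requires it to be neither zero
    nor infinite.\<close>
  have m: "?m \<noteq> 0" "?m \<noteq> top"
    using assms(1) unit_ball_vol_pos[of "real DIM('a)", THEN less_imp_neq] by (auto simp: emeasure_ball simp del: unit_ball_vol_pos)
  have "?I / ?m \<le> HLmax F x"
    unfolding HLmax_def using assms by (intro SUP_upper2[of "(c, r)"]) auto
  then have "?m * (?I / ?m) \<le> ?m * HLmax F x"
    by (intro mult_left_mono) auto
  moreover have "?m * (?I / ?m) = ?I"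
    using ennreal_mult_divide_eq[OF m, of ?I] by (simp only: ennreal_times_divide mult.commute[of ?m])
  ultimately show ?thesis by simp
qed

text \<open>The supremum runs over all balls containing \<open>x\<close>, not only those centred
  there, so a superlevel set is a union of open balls.\<close>

lemma HLmax_measurable [measurable]: "HLmax F \<in> borel_measurable lebesgue"
proof (rule borel_measurable_open_superlevel)
  fix c
  let ?a = "\<lambda>cr. (\<integral>\<^sup>+ y\<in>ball (fst cr) (snd cr). F y \<partial>lebesgue)
    / emeasure lebesgue (ball (fst cr) (snd cr))"
  have "x \<in> (\<Union>cr\<in>{cr. 0 < snd cr \<and> c < ?a cr}. ball (fst cr) (snd cr)) \<longleftrightarrow> c < HLmax F x" for x
    unfolding HLmax_def less_SUP_iff case_prod_beta by blast
  then have "{x. c < HLmax F x} = (\<Union>cr\<in>{cr. 0 < snd cr \<and> c < ?a cr}. ball (fst cr) (snd cr))"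
    by blast
  then show "open {x. c < HLmax F x}"
    by auto
qed

lemma HLmax_add_le:
  assumes [measurable]: "F \<in> borel_measurable lebesgue" "G \<in> borel_measurable lebesgue"
  shows "HLmax (\<lambda>y. F y + G y) x \<le> HLmax F x + HLmax G x"
proof -
  have "(\<integral>\<^sup>+ y\<in>ball c r. (F y + G y) \<partial>lebesgue) / emeasure lebesgue (ball c r)
      \<le> HLmax F x + HLmax G x" if "0 < r" "x \<in> ball c r" for c r
  proof -
    have [measurable]: "ball c r \<in> sets lebesgue"
      by simp
    have "(\<integral>\<^sup>+ y\<in>ball c r. (F y + G y) \<partial>lebesgue)
        = (\<integral>\<^sup>+ y\<in>ball c r. F y \<partial>lebesgue) + (\<integral>\<^sup>+ y\<in>ball c r. G y \<partial>lebesgue)"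
      by (simp add: distrib_right nn_integral_add)
    then show ?thesis
      unfolding HLmax_def using that
      by (auto simp: add_divide_distrib_ennreal intro!: add_mono SUP_upper2[of "(c, r)"])
  qed
  then show ?thesis
    by (subst HLmax_def) (auto intro!: SUP_least)
qed

section \<open>Cones of different apertures\<close>

definition cone_at :: "real \<Rightarrow> 'a::euclidean_space \<Rightarrow> ('a \<times> real) set" where
  "cone_at a x = {z. 0 < snd z \<and> dist x (fst z) < a * snd z}"

text \<open>Half-open in height, so that the slices at consecutive powers of 2 are disjoint and
  leave no gap.\<close>

definition slice :: "real \<Rightarrow> ('a \<times> real) set" where
  "slice t = {z. t \<le> snd z \<and> snd z < 2 * t}"

lemma open_cone_at: "open (cone_at a x)"
  unfolding cone_at_def by (intro open_Collect_conj open_Collect_less continuous_intros)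

lemma cone_at_sets [measurable, simp]: "cone_at a x \<in> sets lebesgue"
  using open_cone_at[of a x] by (intro sets_completionI_sets) simp

lemma slice_sets [measurable, simp]: "slice t \<in> sets (lebesgue :: ('a::euclidean_space \<times> real) measure)"
proof -
  have "closed {z :: 'a \<times> real. t \<le> snd z}" "open {z :: 'a \<times> real. snd z < 2 * t}"
    by (intro closed_Collect_le open_Collect_less continuous_intros)+
  then have "slice t \<in> sets (borel :: ('a \<times> real) measure)"
    unfolding slice_def Collect_conj_eq by (intro sets.Int borel_closed borel_open)
  then show ?thesis
    by (intro sets_completionI_sets) simp
qed

lemma emeasure_cone_measurable:
  fixes \<mu> :: "('a::euclidean_space \<times> real) measure"
  assumes [simp]: "sets \<mu> = sets lebesgue" and A [simp]: "A \<in> sets lebesgue"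
  shows "(\<lambda>x. emeasure \<mu> (cone_at a x \<inter> A)) \<in> borel_measurable lebesgue"
proof (rule borel_measurable_open_superlevel, unfold open_contains_ball, intro ballI)
  fix c x assume "x \<in> {x. c < emeasure \<mu> (cone_at a x \<inter> A)}"
  then have c: "c < emeasure \<mu> (cone_at a x \<inter> A)"
    by simp
  \<comment> \<open>The slack \<open>1 / Suc m\<close> gives lower semicontinuity in the vertex: by
    the triangle inequality \<open>D m\<close> stays inside every cone whose vertex is closer to
    \<open>x\<close> than the slack, and the \<open>D m\<close> exhaust the cone at
    \<open>x\<close>.\<close>
  define D where "D m = {z. 0 < snd z \<and> dist x (fst z) + 1 / Suc m < a * snd z}" for m :: nat
  have "open (D m)" for m
    unfolding D_def by (intro open_Collect_conj open_Collect_less continuous_intros)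
  then have D: "D m \<in> sets lebesgue" for m
    by (intro sets_completionI_sets) simp
  have "incseq (\<lambda>m. D m \<inter> A)"
  proof (rule incseq_SucI)
    fix m
    have "1 / real (Suc (Suc m)) \<le> 1 / real (Suc m)"
      by (simp add: frac_le)
    then show "D m \<inter> A \<le> D (Suc m) \<inter> A"
      unfolding D_def by (auto simp del: of_nat_Suc)
  qed
  then have "(SUP m. emeasure \<mu> (D m \<inter> A)) = emeasure \<mu> (\<Union>m. D m \<inter> A)"
    using D by (intro SUP_emeasure_incseq) auto
  also have "(\<Union>m. D m \<inter> A) = cone_at a x \<inter> A"
  proof -
    have "\<exists>m. z \<in> D m" if "z \<in> cone_at a x" for z
    proof -
      from that obtain m where "1 / real (Suc m) < a * snd z - dist x (fst z)"
        using nat_approx_posE[of "a * snd z - dist x (fst z)"] unfolding cone_at_def by auto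
      then show ?thesis
        using that by (intro exI[of _ m]) (auto simp: D_def cone_at_def)
    qed
    moreover have "D m \<subseteq> cone_at a x" for m
    proof -
      have "0 < 1 / real (Suc m)" by simp
      then have "d < e" if "d + 1 / real (Suc m) < e" for d e
        using that by linarith
      then show ?thesis
        unfolding D_def cone_at_def by blast
    qed
    ultimately show ?thesis by blast
  qed
  finally have "c < (SUP m. emeasure \<mu> (D m \<inter> A))"
    using c by simp
  then obtain m where m: "c < emeasure \<mu> (D m \<inter> A)"
    unfolding less_SUP_iff by blast
  have "c < emeasure \<mu> (cone_at a y \<inter> A)" if y: "y \<in> ball x (1 / Suc m)" for y
  proof -
    have "D m \<subseteq> cone_at a y"
    proof
      fix z assume "z \<in> D m"
      then show "z \<in> cone_at a y"
        using y dist_triangle[of y "fst z" x] unfolding D_def cone_at_def by (auto simp: dist_commute)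
    qed
    then have "emeasure \<mu> (D m \<inter> A) \<le> emeasure \<mu> (cone_at a y \<inter> A)"
      by (intro emeasure_mono) auto
    then show ?thesis using m by simp
  qed
  then show "\<exists>e>0. ball x e \<subseteq> {x. c < emeasure \<mu> (cone_at a x \<inter> A)}"
    by (intro exI[of _ "1 / Suc m"] conjI subsetI CollectI) auto
qed

text \<open>Compactness leaves finitely many balls of one radius; the Vitali selection keeps a
  disjoint subfamily whose fivefold enlargements still cover.\<close>

lemma finite_separated_cover:
  fixes x :: "'a::euclidean_space"
  assumes "0 < \<rho>"
  obtains C where "finite C" "C \<subseteq> cball x R" "disjoint_family_on (\<lambda>c. ball c \<rho>) C"
    "cball x R \<subseteq> (\<Union>c\<in>C. ball c (5 * \<rho>))"
proof -
  have "cball x R \<subseteq> (\<Union>c\<in>cball x R. ball c \<rho>)"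
    using assms by force
  then obtain K where K: "K \<subseteq> cball x R" "finite K" "cball x R \<subseteq> (\<Union>c\<in>K. ball c \<rho>)"
    by (rule compactE_image[OF compact_cball open_ball])
  have r: "\<And>c. c \<in> K \<Longrightarrow> 0 < \<rho> \<and> \<rho> \<le> \<rho>"
    using assms by simp
  show ?thesis
  proof (rule Vitali_covering_lemma_balls[OF K(3) r])
    fix C assume C: "C \<subseteq> K" "pairwise (\<lambda>i j. disjnt (ball i \<rho>) (ball j \<rho>)) C"
      "cball x R \<subseteq> (\<Union>i\<in>C. ball i (5 * \<rho>))"
    show thesis
    proof (rule that[OF _ _ _ C(3)])
      show "finite C" "C \<subseteq> cball x R"
        using C(1) K(1,2) finite_subset by blast+
      show "disjoint_family_on (\<lambda>c. ball c \<rho>) C"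
        using C(2) unfolding disjoint_family_on_def pairwise_def disjnt_def by blast
    qed
  qed
qed

text \<open>A piece of the slice over a ball of radius t / 2 lies in the unit cones of all vertices within
  t / 10 of the centre. As s \<le> 1, the measure of the union is controlled by the l^s-sum of the
  pieces, hence by an average of the s-th power of the unit-cone measure.\<close>
lemma emeasure_cone_slice_le:
  fixes \<mu> :: "('a::euclidean_space \<times> real) measure"
  assumes sets [simp]: "sets \<mu> = sets lebesgue" and "0 < s" "s \<le> 1" "0 < t" "1 \<le> a"
  shows "epowr (emeasure \<mu> (cone_at a x \<inter> slice t)) s
    \<le> ennreal ((30 * a) ^ DIM('a)) * HLmax (\<lambda>y. epowr (emeasure \<mu> (cone_at 1 y \<inter> slice t)) s) x"
proof -
  define u where "u y = epowr (emeasure \<mu> (cone_at 1 y \<inter> slice t)) s" for y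
  have u_meas [measurable]: "u \<in> borel_measurable lebesgue"
    unfolding u_def by (intro borel_measurable_epowr emeasure_cone_measurable) simp_all
  \<comment> \<open>Small enough that \<open>5 * \<rho> + \<rho> < t\<close>: a point of
    \<open>P c\<close> is then closer to each vertex in \<open>ball c \<rho>\<close> than its own
    height.\<close>
  define \<rho> where "\<rho> = t / 10"
  have \<rho>: "0 < \<rho>" using assms by (simp add: \<rho>_def)
  \<comment> \<open>Heights in the slice stay below \<open>2 * t\<close>, so the wide cone projects
    into the ball of radius \<open>2 * a * t\<close>.\<close>
  obtain C where C: "finite C" "C \<subseteq> cball x (2 * a * t)" "disjoint_family_on (\<lambda>c. ball c \<rho>) C"
    "cball x (2 * a * t) \<subseteq> (\<Union>c\<in>C. ball c (5 * \<rho>))"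
    using finite_separated_cover[OF \<rho>] by metis
  define P :: "'a \<Rightarrow> ('a \<times> real) set" where "P c = (ball c (5 * \<rho>) \<times> UNIV) \<inter> slice t" for c
  have "open (ball c (5 * \<rho>) \<times> (UNIV :: real set))" for c :: 'a
    by (intro open_Times) auto
  then have P [simp]: "P c \<in> sets lebesgue" for c
    unfolding P_def by (intro sets.Int sets_completionI_sets slice_sets) simp
  \<comment> \<open>The radius \<open>30 * a * \<rho>\<close> equals \<open>3 * a * t\<close>,
    enough to hold every small ball centred within \<open>2 * a * t\<close> of \<open>x\<close>. The
    volume ratio is the constant of the lemma.\<close>
  have ball_eq: "emeasure lebesgue (ball c (30 * a * \<rho>)) = ennreal ((30 * a) ^ DIM('a)) * emeasure lebesgue (ball d \<rho>)"
    for c d :: 'a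
    using \<rho> assms by (simp add: emeasure_ball power_mult_distrib mult_ac flip: ennreal_mult)
  define m where "m = emeasure lebesgue (ball (0::'a) \<rho>)"
  have m_eq: "emeasure lebesgue (ball c \<rho>) = m" for c :: 'a
    using \<rho> by (simp add: m_def emeasure_ball)
  have m: "m \<noteq> 0" "m \<noteq> top"
    using \<rho> unit_ball_vol_pos[of "real DIM('a)", THEN less_imp_neq]
    by (auto simp: m_def emeasure_ball simp del: unit_ball_vol_pos)
  have cover: "cone_at a x \<inter> slice t \<subseteq> (\<Union>c\<in>C. P c)"
  proof
    fix z assume z: "z \<in> cone_at a x \<inter> slice t"
    then have "dist x (fst z) < a * snd z" "a * snd z \<le> a * (2 * t)"
      using assms by (auto simp: cone_at_def slice_def intro!: mult_left_mono)
    then have "fst z \<in> cball x (2 * a * t)"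
      by simp
    then obtain c where "c \<in> C" "fst z \<in> ball c (5 * \<rho>)"
      using C(4) by blast
    then show "z \<in> (\<Union>c\<in>C. P c)"
      using z by (auto simp: P_def mem_Times_iff)
  qed
  have "epowr (emeasure \<mu> (cone_at a x \<inter> slice t)) s \<le> epowr (\<Sum>c\<in>C. emeasure \<mu> (P c)) s"
  proof (intro epowr_mono)
    have "emeasure \<mu> (cone_at a x \<inter> slice t) \<le> emeasure \<mu> (\<Union>c\<in>C. P c)"
      using cover C by (intro emeasure_mono) auto
    also have "\<dots> \<le> (\<Sum>c\<in>C. emeasure \<mu> (P c))"
      using C by (intro emeasure_subadditive_finite) auto
    finally show "emeasure \<mu> (cone_at a x \<inter> slice t) \<le> (\<Sum>c\<in>C. emeasure \<mu> (P c))" .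
  qed (use assms in simp)
  also have "\<dots> \<le> (\<Sum>c\<in>C. epowr (emeasure \<mu> (P c)) s)"
    by (rule epowr_sum_le) fact+
  \<comment> \<open>The factor \<open>m\<close> turns each term into an integral of a constant over
    a small ball; it cancels at the end against the volume of the large ball.\<close>
  finally have "m * epowr (emeasure \<mu> (cone_at a x \<inter> slice t)) s \<le> (\<Sum>c\<in>C. m * epowr (emeasure \<mu> (P c)) s)"
    by (simp add: mult_left_mono flip: sum_distrib_left)
  also have "\<dots> \<le> (\<Sum>c\<in>C. \<integral>\<^sup>+ y\<in>ball c \<rho>. u y \<partial>lebesgue)"
  proof (intro sum_mono)
    fix c assume "c \<in> C"
    have "epowr (emeasure \<mu> (P c)) s \<le> u y" if y: "y \<in> ball c \<rho>" for y
      unfolding u_def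
    proof (intro epowr_mono emeasure_mono subsetI)
      fix z assume "z \<in> P c"
      then show "z \<in> cone_at 1 y \<inter> slice t"
        using y dist_triangle[of y "fst z" c] \<rho>
        by (auto simp: P_def cone_at_def slice_def \<rho>_def dist_commute)
    qed (use assms in auto)
    then have "(\<integral>\<^sup>+ y\<in>ball c \<rho>. epowr (emeasure \<mu> (P c)) s \<partial>lebesgue) \<le> (\<integral>\<^sup>+ y\<in>ball c \<rho>. u y \<partial>lebesgue)"
      by (intro nn_integral_mono) (simp split: split_indicator)
    then show "m * epowr (emeasure \<mu> (P c)) s \<le> (\<integral>\<^sup>+ y\<in>ball c \<rho>. u y \<partial>lebesgue)"
      using m_eq[of c] nn_integral_cmult_indicator[of "ball c \<rho>" lebesgue "epowr (emeasure \<mu> (P c)) s"]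
      by (simp add: mult.commute[of m])
  qed
  also have "\<dots> = (\<integral>\<^sup>+ y. (\<Sum>c\<in>C. u y * indicator (ball c \<rho>) y) \<partial>lebesgue)"
    by (intro nn_integral_sum[symmetric] borel_measurable_times_ennreal u_meas borel_measurable_indicator) simp
  also have "\<dots> \<le> (\<integral>\<^sup>+ y\<in>ball x (30 * a * \<rho>). u y \<partial>lebesgue)"
  proof (intro nn_integral_mono)
    fix y
    \<comment> \<open>Disjointness of the small balls keeps the constant independent of the number
      of points in \<open>C\<close>.\<close>
    have "(\<Sum>c\<in>C. indicator (ball c \<rho>) y :: ennreal) = indicator (\<Union>c\<in>C. ball c \<rho>) y"
      using C by (intro indicator_UN_disjoint[symmetric]) auto
    moreover have "(\<Union>c\<in>C. ball c \<rho>) \<subseteq> ball x (30 * a * \<rho>)"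
    proof
      fix y assume "y \<in> (\<Union>c\<in>C. ball c \<rho>)"
      then obtain c where c: "dist x c \<le> 2 * a * t" "dist c y < \<rho>"
        using C by (auto simp: subset_iff)
      have "t \<le> a * t" using assms by simp
      then have "dist x y < 3 * (a * t)"
        using c dist_triangle[of x y c] \<rho> unfolding \<rho>_def by linarith
      then show "y \<in> ball x (30 * a * \<rho>)"
        by (simp add: \<rho>_def)
    qed
    ultimately show "(\<Sum>c\<in>C. u y * indicator (ball c \<rho>) y) \<le> u y * indicator (ball x (30 * a * \<rho>)) y"
      by (auto simp only: sum_distrib_left[symmetric] zero_le intro!: mult_left_mono split: split_indicator)
  qed
  also have "\<dots> \<le> emeasure lebesgue (ball x (30 * a * \<rho>)) * HLmax u x"
    using \<rho> assms by (intro HLmax_ge) auto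
  also have "\<dots> = m * (ennreal ((30 * a) ^ DIM('a)) * HLmax u x)"
    unfolding ball_eq[of x 0] m_eq by (simp add: mult_ac)
  finally show ?thesis
    using m by (simp add: ennreal_mult_le_mult_iff u_def[abs_def])
qed

section \<open>Dyadic decomposition of cones in height\<close>

text \<open>Slices are naturally indexed by integers; \<open>int_decode\<close> re-indexes them by
  naturals, the index type in \<open>FS_condition\<close>.\<close>

definition dyadic :: "nat \<Rightarrow> real" where
  "dyadic j = 2 powr real_of_int (int_decode j)"

lemma dyadic_pos [simp]: "0 < dyadic j"
  by (simp add: dyadic_def)

text \<open>The height alone determines the index, which yields at once that the slices are disjoint
  and that they cover the half-space.\<close>

lemma mem_slice_dyadic: "z \<in> slice (dyadic j) \<longleftrightarrow> 0 < snd z \<and> int_decode j = \<lfloor>log 2 (snd z)\<rfloor>"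
proof -
  have "2 * dyadic j = 2 powr (real_of_int (int_decode j) + 1)"
    by (simp add: dyadic_def powr_add)
  moreover have "0 < snd z" if "dyadic j \<le> snd z"
    using that dyadic_pos[of j] by linarith
  moreover have "0 < snd z \<Longrightarrow> snd z = 2 powr log 2 (snd z)"
    by simp
  ultimately show ?thesis
    unfolding slice_def dyadic_def
    by (auto simp: floor_eq_iff eq_commute[of "int_decode j"] le_log_iff log_less_iff)
qed

lemma emeasure_cone_eq_suminf:
  fixes \<mu> :: "('a::euclidean_space \<times> real) measure"
  assumes [simp]: "sets \<mu> = sets lebesgue"
  shows "emeasure \<mu> (cone_at a x) = (\<Sum>j. emeasure \<mu> (cone_at a x \<inter> slice (dyadic j)))"
proof -
  have "\<exists>j. z \<in> slice (dyadic j)" if "z \<in> cone_at a x" for z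
    using that by (intro exI[of _ "int_encode \<lfloor>log 2 (snd z)\<rfloor>"]) (simp add: mem_slice_dyadic cone_at_def)
  then have "(\<Union>j. cone_at a x \<inter> slice (dyadic j)) = cone_at a x"
    by blast
  moreover have "disjoint_family (\<lambda>j. cone_at a x \<inter> slice (dyadic j))"
    unfolding disjoint_family_on_def by (auto simp: mem_slice_dyadic) (metis int_decode_inverse)
  ultimately show ?thesis
    by (subst suminf_emeasure) auto
qed

text \<open>The slice bounds are raised to the power \<open>1 / s\<close> before they are added,
  which turns the volume ratio into its power \<open>1 / s\<close>.\<close>

lemma emeasure_cone_le:
  fixes \<mu> :: "('a::euclidean_space \<times> real) measure"
  assumes sets: "sets \<mu> = sets lebesgue" and "0 < s" "s \<le> 1" "1 \<le> a"
  shows "emeasure \<mu> (cone_at a x) \<le> ennreal ((30 * a) powr (DIM('a) / s))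
    * (\<Sum>j. epowr (HLmax (\<lambda>y. epowr (emeasure \<mu> (cone_at 1 y \<inter> slice (dyadic j))) s) x) (1 / s))"
proof -
  have "emeasure \<mu> (cone_at a x \<inter> slice (dyadic j)) \<le> ennreal ((30 * a) powr (DIM('a) / s))
    * epowr (HLmax (\<lambda>y. epowr (emeasure \<mu> (cone_at 1 y \<inter> slice (dyadic j))) s) x) (1 / s)" for j
  proof -
    have "epowr (epowr (emeasure \<mu> (cone_at a x \<inter> slice (dyadic j))) s) (1 / s)
      \<le> epowr (ennreal ((30 * a) ^ DIM('a))
        * HLmax (\<lambda>y. epowr (emeasure \<mu> (cone_at 1 y \<inter> slice (dyadic j))) s) x) (1 / s)"
      using assms by (intro epowr_mono emeasure_cone_slice_le) auto
    then show ?thesis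
      using assms by (simp add: epowr_epowr epowr_mult epowr_ennreal powr_powr powr_mult flip: powr_realpow)
  qed
  then show ?thesis
    unfolding emeasure_cone_eq_suminf[OF sets, of a] ennreal_suminf_cmult[symmetric]
    by (intro suminf_le) auto
qed

text \<open>Makes the square of the functional a measure of the cone, hence countably additive over
  slices. The values of the density at \<open>snd z \<le> 0\<close> do not matter, since cones lie
  in the open half-space.\<close>

lemma conical_A_eq:
  fixes F :: "'a::euclidean_space \<times> real \<Rightarrow> real"
  assumes [measurable]: "F \<in> borel_measurable lebesgue"
  shows "conical_A a F x
    = epowr (emeasure (density lebesgue (\<lambda>z. ennreal ((F z)\<^sup>2 / snd z ^ (DIM('a) + 1)))) (cone_at a x)) (1 / 2)"
proof -
  have "(\<lambda>z::'a \<times> real. snd z) \<in> borel_measurable lebesgue"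
    by (intro measurable_completion) (simp add: borel_measurable_continuous_onI continuous_on_snd)
  then have "(\<lambda>z. ennreal ((F z)\<^sup>2 / snd z ^ (DIM('a) + 1))) \<in> borel_measurable lebesgue"
    by measurable
  then show ?thesis
    unfolding conical_A_def cone_at_def[symmetric] by (subst emeasure_density) simp_all
qed

section \<open>Weak-type estimates in ball quasi-Banach function spaces\<close>

lemma bqb_mono:
  assumes "ball_quasi_banach_function_space X"
    and "F \<in> borel_measurable lebesgue" "G \<in> borel_measurable lebesgue" "\<And>x. G x \<le> F x"
  shows "X G \<le> X F"
  using assms unfolding ball_quasi_banach_function_space_def by (auto; blast)

lemma bqb_Fatou:
  assumes "ball_quasi_banach_function_space X"
    and "\<And>m. Fs m \<in> borel_measurable lebesgue" "F \<in> borel_measurable lebesgue"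
    and "\<And>x. incseq (\<lambda>m. Fs m x)" "\<And>x. (\<lambda>m. Fs m x) \<longlonglongrightarrow> F x"
  shows "(\<lambda>m. X (Fs m)) \<longlonglongrightarrow> X F"
  using assms unfolding ball_quasi_banach_function_space_def by auto

section \<open>Passage from real to extended-valued functions\<close>

text \<open>Homogeneity and the quasi-triangle inequality are given for real functions only. These
  real-valued truncations increase to \<open>F\<close>, also where \<open>F\<close> is infinite, so
  the Fatou property transfers both.\<close>

definition trunc :: "nat \<Rightarrow> ('a \<Rightarrow> ennreal) \<Rightarrow> 'a \<Rightarrow> real" where
  "trunc m F x = enn2real (min (F x) (of_nat m))"

lemma fmod_trunc: "fmod (trunc m F) = (\<lambda>x. min (F x) (of_nat m))"
  by (auto simp: fmod_def trunc_def min_less_iff_disj of_nat_less_top)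

lemma trunc_measurable [measurable]:
  "F \<in> borel_measurable M \<Longrightarrow> trunc m F \<in> borel_measurable M"
  unfolding trunc_def by measurable

lemma fmod_trunc_incseq: "incseq (\<lambda>m. fmod (trunc m F) x)"
  by (auto simp: fmod_trunc incseq_def min_le_iff_disj intro!: min.mono)

lemma fmod_trunc_tendsto: "(\<lambda>m. fmod (trunc m F) x) \<longlonglongrightarrow> F x"
  unfolding fmod_trunc
  using tendsto_min[OF tendsto_const of_nat_tendsto_top_ennreal, of "F x"] by simp

lemma fmod_measurable [measurable]:
  "f \<in> borel_measurable M \<Longrightarrow> fmod f \<in> borel_measurable M"
  unfolding fmod_def by measurable

lemma bqb_cmult:
  assumes X: "ball_quasi_banach_function_space X" and [measurable]: "F \<in> borel_measurable lebesgue"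
    and c: "0 \<le> c"
  shows "X (\<lambda>x. ennreal c * F x) = ennreal c * X F"
proof (rule LIMSEQ_unique)
  have eq: "fmod (\<lambda>x. c * trunc m F x) = (\<lambda>x. ennreal c * fmod (trunc m F) x)" for m
    using c by (auto simp: fmod_def abs_mult ennreal_mult)
  have "(\<lambda>m. X (fmod (\<lambda>x. c * trunc m F x))) \<longlonglongrightarrow> X (\<lambda>x. ennreal c * F x)"
  proof (rule bqb_Fatou[OF X])
    show "incseq (\<lambda>m. fmod (\<lambda>x. c * trunc m F x) x)" for x
      using fmod_trunc_incseq[of F x] unfolding eq by (auto simp: incseq_def intro: mult_left_mono)
    show "(\<lambda>m. fmod (\<lambda>x. c * trunc m F x) x) \<longlonglongrightarrow> ennreal c * F x" for x
      unfolding eq by (intro ennreal_tendsto_cmult fmod_trunc_tendsto) simp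
  qed measurable
  moreover have "X (fmod (\<lambda>x. c * trunc m F x)) = ennreal c * X (fmod (trunc m F))" for m
    using X c unfolding ball_quasi_banach_function_space_def by simp
  ultimately show "(\<lambda>m. ennreal c * X (fmod (trunc m F))) \<longlonglongrightarrow> X (\<lambda>x. ennreal c * F x)"
    by simp
  show "(\<lambda>m. ennreal c * X (fmod (trunc m F))) \<longlonglongrightarrow> ennreal c * X F"
    by (intro ennreal_tendsto_cmult bqb_Fatou[OF X] fmod_trunc_incseq fmod_trunc_tendsto) auto
qed

definition quasi_const :: "(('a::euclidean_space \<Rightarrow> ennreal) \<Rightarrow> ennreal) \<Rightarrow> real \<Rightarrow> bool" where
  "quasi_const X K \<longleftrightarrow> 1 \<le> K \<and>
    (\<forall>F G. F \<in> borel_measurable lebesgue \<longrightarrow> G \<in> borel_measurable lebesgue \<longrightarrow>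
      X (\<lambda>x. F x + G x) \<le> ennreal K * (X F + X G))"

lemma bqb_quasi_const:
  assumes X: "ball_quasi_banach_function_space X"
  obtains K where "quasi_const X K"
proof -
  obtain K where K: "1 \<le> K" and tri: "\<And>f g. f \<in> borel_measurable lebesgue \<Longrightarrow>
      g \<in> borel_measurable lebesgue \<Longrightarrow> X (fmod (\<lambda>x. f x + g x)) \<le> ennreal K * (X (fmod f) + X (fmod g))"
    using X unfolding ball_quasi_banach_function_space_def by blast
  have "X (\<lambda>x. F x + G x) \<le> ennreal K * (X F + X G)"
    if [measurable]: "F \<in> borel_measurable lebesgue" "G \<in> borel_measurable lebesgue" for F G
  proof (rule LIMSEQ_le_const2)
    have eq: "fmod (\<lambda>x. trunc m F x + trunc m G x) = (\<lambda>x. fmod (trunc m F) x + fmod (trunc m G) x)" for m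
      by (auto simp: fmod_def trunc_def)
    show "(\<lambda>m. X (fmod (\<lambda>x. trunc m F x + trunc m G x))) \<longlonglongrightarrow> X (\<lambda>x. F x + G x)"
    proof (rule bqb_Fatou[OF X])
      show "incseq (\<lambda>m. fmod (\<lambda>x. trunc m F x + trunc m G x) x)" for x
        using fmod_trunc_incseq[of F x] fmod_trunc_incseq[of G x] unfolding eq
        by (auto simp: incseq_def intro: add_mono)
      show "(\<lambda>m. fmod (\<lambda>x. trunc m F x + trunc m G x) x) \<longlonglongrightarrow> F x + G x" for x
        unfolding eq by (intro tendsto_add fmod_trunc_tendsto)
    qed measurable
    have "X (fmod (\<lambda>x. trunc m F x + trunc m G x)) \<le> ennreal K * (X F + X G)" for m
    proof -
      have "X (fmod (trunc m F)) \<le> X F" "X (fmod (trunc m G)) \<le> X G"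
        by (intro bqb_mono[OF X]; simp add: fmod_trunc)+
      then have "ennreal K * (X (fmod (trunc m F)) + X (fmod (trunc m G))) \<le> ennreal K * (X F + X G)"
        by (intro mult_left_mono add_mono) auto
      with tri[of "trunc m F" "trunc m G"] show ?thesis
        by (auto intro: order_trans)
    qed
    then show "\<exists>N. \<forall>m\<ge>N. X (fmod (\<lambda>x. trunc m F x + trunc m G x)) \<le> ennreal K * (X F + X G)"
      by blast
  qed
  with K show ?thesis
    by (intro that[of K]) (auto simp: quasi_const_def)
qed

text \<open>Splitting off the first term costs one factor \<open>K\<close> for it and for everything
  after it, so the term of index \<open>j\<close> collects \<open>Suc j\<close> factors. The Fatou
  property passes from partial sums to the series.\<close>

lemma bqb_suminf_le:
  assumes X: "ball_quasi_banach_function_space X" and K: "quasi_const X K"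
    and F: "\<And>j. F j \<in> borel_measurable lebesgue"
  shows "X (\<lambda>x. \<Sum>j. F j x) \<le> (\<Sum>j. ennreal (K ^ Suc j) * X (F j))"
proof (rule LIMSEQ_le_const2)
  have K1: "1 \<le> K"
    and tri: "\<And>F G. F \<in> borel_measurable lebesgue \<Longrightarrow> G \<in> borel_measurable lebesgue \<Longrightarrow>
      X (\<lambda>x. F x + G x) \<le> ennreal K * (X F + X G)"
    using K by (auto simp: quasi_const_def)
  have "X (\<lambda>x. 0) = 0"
    using bqb_cmult[OF X, of "\<lambda>_. 0" 0] by simp
  then have "X (\<lambda>x. \<Sum>j<m. F j x) \<le> (\<Sum>j<m. ennreal (K ^ Suc j) * X (F j))" for m
    using F
  proof (induction m arbitrary: F)
    case (Suc m)
    have "X (\<lambda>x. \<Sum>j<Suc m. F j x) = X (\<lambda>x. F 0 x + (\<Sum>j<m. F (Suc j) x))"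
      by (simp add: sum.lessThan_Suc_shift del: sum.lessThan_Suc)
    also have "\<dots> \<le> ennreal K * (X (F 0) + X (\<lambda>x. \<Sum>j<m. F (Suc j) x))"
      using Suc.prems by (intro tri) auto
    also have "\<dots> \<le> ennreal K * (X (F 0) + (\<Sum>j<m. ennreal (K ^ Suc j) * X (F (Suc j))))"
      using Suc by (intro mult_left_mono add_left_mono Suc.IH) auto
    also have "\<dots> = (\<Sum>j<Suc m. ennreal (K ^ Suc j) * X (F j))"
      using K1 by (simp add: sum.lessThan_Suc_shift distrib_left sum_distrib_left ennreal_mult mult.assoc
          del: sum.lessThan_Suc)
    finally show ?case .
  qed simp
  then have "X (\<lambda>x. \<Sum>j<m. F j x) \<le> (\<Sum>j. ennreal (K ^ Suc j) * X (F j))" for m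
    by (rule order_trans) (auto intro!: sum_le_suminf)
  then show "\<exists>N. \<forall>m\<ge>N. X (\<lambda>x. \<Sum>j<m. F j x) \<le> (\<Sum>j. ennreal (K ^ Suc j) * X (F j))"
    by blast
  show "(\<lambda>m. X (\<lambda>x. \<Sum>j<m. F j x)) \<longlonglongrightarrow> X (\<lambda>x. \<Sum>j. F j x)"
    using F by (intro bqb_Fatou[OF X]) (auto intro!: summable_LIMSEQ incseq_SucI borel_measurable_sum borel_measurable_suminf_order)
qed

section \<open>Estimates by layers between geometric levels\<close>

lemma indicator_superlevel_le_weakX:
  assumes "0 < a"
  shows "X (indicator {x. U x > ennreal a}) \<le> ennreal (1 / a) * weakX X U"
proof -
  have "ennreal a * X (indicator {x. U x > ennreal a}) \<le> weakX X U"
    unfolding weakX_def using assms by (intro SUP_upper) auto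
  then have "ennreal (1 / a) * (ennreal a * X (indicator {x. U x > ennreal a})) \<le> ennreal (1 / a) * weakX X U"
    by (rule mult_left_mono) simp
  moreover have "ennreal (1 / a) * (ennreal a * y) = y" for y
    using assms by (simp flip: mult.assoc ennreal_mult)
  ultimately show ?thesis by simp
qed

text \<open>Levels in geometric progression with a ratio so large that the decay beats the powers of the
  quasi-triangle constant.\<close>
lemma bqb_level_sum_le:
  assumes X: "ball_quasi_banach_function_space X" and K: "quasi_const X K"
    and U [measurable]: "U \<in> borel_measurable lebesgue" and V [measurable]: "V \<in> borel_measurable lebesgue"
    and pos: "\<And>j. 0 < a j" "\<And>j. 0 \<le> c j" "0 \<le> D"
    and decay: "\<And>j. K ^ Suc j * (c j / a j) \<le> D * (1/2) ^ Suc j"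
    and le: "\<And>x. V x \<le> (\<Sum>j. ennreal (c j) * indicator {x. U x > ennreal (a j)} x)"
  shows "X V \<le> ennreal D * weakX X U"
proof -
  have K1: "1 \<le> K" using K by (simp add: quasi_const_def)
  have [measurable]: "indicator {x. U x > ennreal b} \<in> borel_measurable lebesgue" for b
    by measurable
  have "X V \<le> X (\<lambda>x. \<Sum>j. ennreal (c j) * indicator {x. U x > ennreal (a j)} x)"
    using le by (intro bqb_mono[OF X]) auto
  also have "\<dots> \<le> (\<Sum>j. ennreal (K ^ Suc j) * X (\<lambda>x. ennreal (c j) * indicator {x. U x > ennreal (a j)} x))"
    by (intro bqb_suminf_le[OF X K]) auto
  also have "\<dots> \<le> (\<Sum>j. ennreal (D * (1/2) ^ Suc j) * weakX X U)"
  proof (intro suminf_le allI)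
    fix j
    have "ennreal (K ^ Suc j) * X (\<lambda>x. ennreal (c j) * indicator {x. U x > ennreal (a j)} x)
      = ennreal (K ^ Suc j) * (ennreal (c j) * X (indicator {x. U x > ennreal (a j)}))"
      using bqb_cmult[OF X _ pos(2), of "indicator {x. U x > ennreal (a j)}"] by simp
    also have "\<dots> \<le> ennreal (K ^ Suc j) * (ennreal (c j) * (ennreal (1 / a j) * weakX X U))"
      by (intro mult_left_mono indicator_superlevel_le_weakX pos) auto
    also have "\<dots> = ennreal (K ^ Suc j * (c j / a j)) * weakX X U"
      using pos(1)[of j] pos(2)[of j] K1 by (simp add: mult.assoc flip: ennreal_mult)
         (simp add: mult.assoc[symmetric] flip: ennreal_mult)
    also have "\<dots> \<le> ennreal (D * (1/2) ^ Suc j) * weakX X U"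
      using decay by (intro mult_right_mono ennreal_leI) auto
    finally show "ennreal (K ^ Suc j) * X (\<lambda>x. ennreal (c j) * indicator {x. U x > ennreal (a j)} x)
      \<le> ennreal (D * (1/2) ^ Suc j) * weakX X U" .
  qed auto
  also have "\<dots> = ennreal D * weakX X U"
  proof -
    have "(\<Sum>j. ennreal (D * (1/2) ^ Suc j)) = ennreal D"
      using sums_mult[OF power_half_series, of D] pos by (intro suminf_ennreal_eq) auto
    then show ?thesis by simp
  qed
  finally show ?thesis .
qed

lemma ex_power_interval:
  fixes B :: real
  assumes "1 < B" "1 < y"
  obtains j :: nat where "B ^ j < y" "y \<le> B ^ Suc j"
proof -
  obtain n where n: "y \<le> B ^ n"
    using real_arch_pow[OF assms(1), of y] by (auto intro: less_imp_le)
  define m where "m = (LEAST n. y \<le> B ^ n)"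
  have m: "y \<le> B ^ m"
    unfolding m_def using n by (rule LeastI)
  then obtain j where j: "m = Suc j"
    using assms by (cases m) auto
  have "\<not> y \<le> B ^ j"
    using not_less_Least[of j "\<lambda>n. y \<le> B ^ n"] j by (auto simp: m_def)
  then show ?thesis
    using m j by (intro that[of j]) auto
qed

text \<open>On the layer between \<open>B ^ j * l\<close> and \<open>B ^ Suc j * l\<close> the
  function is at most \<open>(B ^ Suc j * l) powr r\<close>. As \<open>r < 1\<close>, division by
  the level leaves the decay \<open>B powr (- j * (1 - r))\<close>, which beats
  \<open>(2 * K) ^ j\<close>.\<close>

lemma bqb_upper_part_le:
  assumes X: "ball_quasi_banach_function_space X" and K: "quasi_const X K"
    and U [measurable]: "U \<in> borel_measurable lebesgue"
    and r: "0 < r" "r < 1" and B: "1 < B" "2 * K \<le> B powr (1 - r)" and l: "0 < l"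
  shows "X (\<lambda>x. epowr (U x) r * indicator {x. U x > ennreal l} x)
    \<le> ennreal (2 * K * B powr r * l powr (r - 1)) * weakX X U"
proof (rule bqb_level_sum_le[OF X K U, where a = "\<lambda>j. B ^ j * l" and c = "\<lambda>j. (B ^ Suc j * l) powr r"])
  have K1: "1 \<le> K" using K by (simp add: quasi_const_def)
  show "K ^ Suc j * ((B ^ Suc j * l) powr r / (B ^ j * l)) \<le> 2 * K * B powr r * l powr (r - 1) * (1/2) ^ Suc j" for j
  proof -
    have "(2 * K) ^ j \<le> (B powr (1 - r)) ^ j"
      using K1 B by (intro power_mono) auto
    also have "\<dots> = B ^ j / (B ^ j) powr r"
      using B by (simp add: powr_diff power_divide powr_powr powr_power mult.commute flip: powr_realpow)
    finally have "(2 * K) ^ j * (B ^ j) powr r / B ^ j \<le> 1"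
      using B by (simp add: field_simps)
    then have "K * B powr r * l powr (r - 1) * ((2 * K) ^ j * (B ^ j) powr r / B ^ j) \<le> K * B powr r * l powr (r - 1) * 1"
      using K1 by (intro mult_left_mono) auto
    then show ?thesis
      using B l by (simp add: powr_mult powr_diff power_divide field_simps)
  qed
  show "epowr (U x) r * indicator {x. U x > ennreal l} x
      \<le> (\<Sum>j. ennreal ((B ^ Suc j * l) powr r) * indicator {x. U x > ennreal (B ^ j * l)} x)" (is "_ \<le> ?S") for x
  proof (cases "U x > ennreal l")
    case gt: True
    show ?thesis
    proof (cases "U x")
      case (real y)
      then have "1 < y / l"
        using gt l by (simp add: ennreal_less_iff)
      then obtain j where j: "B ^ j < y / l" "y / l \<le> B ^ Suc j"
        using ex_power_interval[OF B(1)] by blast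
      have "epowr (U x) r \<le> ennreal ((B ^ Suc j * l) powr r)"
        unfolding real(2) using j real l r by (auto simp: epowr_ennreal field_simps intro!: ennreal_leI powr_mono2)
      also have "\<dots> = (\<Sum>i\<in>{j}. ennreal ((B ^ Suc i * l) powr r) * indicator {x. U x > ennreal (B ^ i * l)} x)"
        using j l B real by (simp add: field_simps ennreal_less_iff)
      also have "\<dots> \<le> ?S"
        by (intro sum_le_suminf) auto
      finally show ?thesis using gt by simp
    next
      \<comment> \<open>No layer contains an infinite value, but then every indicator is 1 and the
        series diverges, its terms being at least \<open>l powr r\<close>.\<close>
      case top
      have "?S = (\<Sum>j. ennreal ((B ^ Suc j * l) powr r))"
        using top by simp
      moreover have "(\<Sum>j. ennreal ((B ^ Suc j * l) powr r)) = Orderings.top"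
      proof (rule ccontr)
        assume "(\<Sum>j. ennreal ((B ^ Suc j * l) powr r)) \<noteq> Orderings.top"
        then have "summable (\<lambda>j. (B ^ Suc j * l) powr r)"
          by (intro summable_suminf_not_top) auto
        then have "(\<lambda>j. (B ^ Suc j * l) powr r) \<longlonglongrightarrow> 0"
          by (rule summable_LIMSEQ_zero)
        moreover have "l powr r \<le> (B ^ Suc j * l) powr r" for j
          using l B r one_le_power[of B "Suc j"] by (intro powr_mono2) (auto simp del: power_Suc)
        ultimately have "l powr r \<le> 0"
          by (intro LIMSEQ_le_const) auto
        then show False using l by simp
      qed
      ultimately show ?thesis by simp
    qed
  qed simp
qed (use B l K in \<open>auto simp: quasi_const_def\<close>)

text \<open>Here the layers descend from \<open>l\<close> to 0. The exponent 2 exceeds 1, so the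
  square over the level decays like \<open>1 / B ^ j\<close>; rounding the value up and the level
  down accounts for \<open>B ^ 3\<close>.\<close>

lemma bqb_lower_part_le:
  assumes X: "ball_quasi_banach_function_space X" and K: "quasi_const X K"
    and U [measurable]: "U \<in> borel_measurable lebesgue"
    and B: "1 < B" "2 * K \<le> B" and l: "0 < l"
  shows "X (\<lambda>x. epowr (U x) 2 * indicator {x. \<not> U x > ennreal l} x)
    \<le> ennreal (2 * K * B ^ 3 * l) * weakX X U"
proof (rule bqb_level_sum_le[OF X K U, where a = "\<lambda>j. l / B ^ Suc j" and c = "\<lambda>j. (l * B / B ^ j)\<^sup>2"])
  have K1: "1 \<le> K" using K by (simp add: quasi_const_def)
  show "K ^ Suc j * ((l * B / B ^ j)\<^sup>2 / (l / B ^ Suc j)) \<le> 2 * K * B ^ 3 * l * (1/2) ^ Suc j" for j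
  proof -
    have "(2 * K) ^ j \<le> B ^ j"
      using K1 B by (intro power_mono) auto
    then have "(2 * K) ^ j / B ^ j \<le> 1"
      using B by (simp add: field_simps)
    then have "K * B ^ 3 * l * ((2 * K) ^ j / B ^ j) \<le> K * B ^ 3 * l * 1"
      using K1 B l by (intro mult_left_mono) auto
    then show ?thesis
      using B l by (simp add: power_divide field_simps power2_eq_square power3_eq_cube)
  qed
  show "epowr (U x) 2 * indicator {x. \<not> U x > ennreal l} x
      \<le> (\<Sum>j. ennreal ((l * B / B ^ j)\<^sup>2) * indicator {x. U x > ennreal (l / B ^ Suc j)} x)" (is "_ \<le> ?S") for x
  proof (cases "U x > ennreal l \<or> U x = 0")
    case False
    then obtain y where y: "U x = ennreal y" "0 < y" "y \<le> l"
      using l by (cases "U x") (auto simp: ennreal_less_iff not_less top_unique order_le_less)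
    \<comment> \<open>The extra factor \<open>B\<close> keeps the number strictly above 1 when
      \<open>y = l\<close>. It also leaves room for the strict inequality
      \<open>l / B ^ Suc j < y\<close> required by the indicator.\<close>
    have "1 < B * (l / y)"
      using y B by (intro less_1_mult') auto
    then obtain j where j: "B ^ j < B * (l / y)" "B * (l / y) \<le> B ^ Suc j"
      using ex_power_interval[OF B(1)] by blast
    have "epowr (U x) 2 \<le> ennreal ((l * B / B ^ j)\<^sup>2)"
    proof -
      have "y \<le> l * B / B ^ j"
        using j y B by (simp add: field_simps)
      then show ?thesis
        using y by (simp add: epowr_ennreal power_mono ennreal_leI)
    qed
    also have "\<dots> = (\<Sum>i\<in>{j}. ennreal ((l * B / B ^ i)\<^sup>2) * indicator {x. U x > ennreal (l / B ^ Suc i)} x)"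
    proof -
      have "l < y * B ^ Suc j"
        using j y l B less_1_mult'[of B "y * B ^ j / l"] by (simp add: field_simps)
      then have "l / B ^ Suc j < y"
        using B by (simp add: field_simps)
      then show ?thesis
        using y l B by (simp add: ennreal_less_iff)
    qed
    also have "\<dots> \<le> ?S"
      by (intro sum_le_suminf) auto
    finally show ?thesis using False by simp
  qed auto
qed (use B l K in \<open>auto simp: quasi_const_def\<close>)

text \<open>At the exponents s and e the Fefferman--Stein condition is used with p = s / e and the
  inner exponent 1 / s.\<close>
lemma FS_condition_power:
  fixes X :: "('a::euclidean_space \<Rightarrow> ennreal) \<Rightarrow> ennreal"
  assumes FS: "FS_condition X pm" and s: "0 < s" "s < 1" and e: "0 < e" "s / e < pm"
  obtains C :: real where "0 \<le> C"
    "\<And>fs. (\<And>j. fs j \<in> borel_measurable lebesgue) \<Longrightarrow>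
      X (\<lambda>x. epowr (\<Sum>j::nat. epowr (HLmax (fs j) x) (1 / s)) e)
        \<le> ennreal C * X (\<lambda>x. epowr (\<Sum>j. epowr (fs j x) (1 / s)) e)"
proof -
  obtain C :: real where C: "\<And>fs :: nat \<Rightarrow> 'a \<Rightarrow> ennreal. (\<And>j. fs j \<in> borel_measurable lebesgue) \<Longrightarrow>
        Xpow X (e / s) (\<lambda>x. epowr (\<Sum>j. epowr (HLmax (fs j) x) (1 / s)) s)
          \<le> ennreal C * Xpow X (e / s) (\<lambda>x. epowr (\<Sum>j. epowr (fs j x) (1 / s)) s)"
    using FS[unfolded FS_condition_def, rule_format, of "s / e" "1 / s"] s e by auto
  have Xpow: "Xpow X (e / s) (\<lambda>x. epowr (G x) s) = epowr (X (\<lambda>x. epowr (G x) e)) (s / e)" for G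
    using s e by (simp add: Xpow_def epowr_epowr)
  have "X (\<lambda>x. epowr (\<Sum>j::nat. epowr (HLmax (fs j) x) (1 / s)) e)
        \<le> ennreal (max 0 C powr (e / s)) * X (\<lambda>x. epowr (\<Sum>j. epowr (fs j x) (1 / s)) e)" (is "?L \<le> _ * ?R")
    if fs: "\<And>j. fs j \<in> borel_measurable lebesgue" for fs
  proof -
    \<comment> \<open>The power \<open>e / s\<close> undoes the outer root in \<open>Xpow\<close>. A
      negative \<open>C\<close> is 0 under \<open>ennreal\<close>, hence
      \<open>max 0 C\<close>.\<close>
    have "epowr (epowr ?L (s / e)) (e / s) \<le> epowr (ennreal (max 0 C) * epowr ?R (s / e)) (e / s)"
      using C[OF fs] s e by (intro epowr_mono) (auto simp: Xpow max_def ennreal_neg)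
    then show ?thesis
      using s e by (simp add: epowr_epowr epowr_mult epowr_ennreal)
  qed
  then show ?thesis
    by (intro that[of "max 0 C powr (e / s)"]) auto
qed

text \<open>Pointwise Chebyshev inequality: where \<open>T\<close> exceeds \<open>l\<^sup>2\<close>,
  the \<open>e\<close>-th power of the quotient is at least 1.\<close>

lemma indicator_superlevel_le_epowr:
  assumes "0 < l" "0 < e"
  shows "indicator {x. T x > ennreal (l\<^sup>2)} x \<le> ennreal (l powr (- (2 * e))) * epowr (T x) e"
proof (cases "T x > ennreal (l\<^sup>2)")
  case True
  have "1 = ennreal (l powr (- (2 * e))) * epowr (ennreal (l\<^sup>2)) e"
    using assms by (simp add: epowr_ennreal powr_powr flip: ennreal_mult powr_numeral powr_add)
  also have "\<dots> \<le> ennreal (l powr (- (2 * e))) * epowr (T x) e"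
    using True assms by (intro mult_left_mono epowr_mono) auto
  finally show ?thesis using True by simp
qed simp

text \<open>Marcinkiewicz-type interpolation: the part of the sequence living where U is large is
  estimated with an exponent below that of X, the part where U is small with one above it.\<close>
lemma weak_maximal_sum_le:
  fixes X :: "('a::euclidean_space \<Rightarrow> ennreal) \<Rightarrow> ennreal"
  assumes X: "ball_quasi_banach_function_space X" and FS: "FS_condition X pm"
    and r: "0 < r" "r < 1" and s: "0 < s" "s < 1" "2 * s / r < pm"
  obtains C :: real where "0 < C"
    "\<And>u U l. (\<And>j. u j \<in> borel_measurable lebesgue) \<Longrightarrow> U = (\<lambda>x. epowr (\<Sum>j::nat. u j x) (1 / 2)) \<Longrightarrow>
      0 < l \<Longrightarrow>
      X (indicator {x. (\<Sum>j. epowr (HLmax (\<lambda>y. epowr (u j y) s) x) (1 / s)) > ennreal (2 powr (1 / s) * (2 * l\<^sup>2))})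
        \<le> ennreal (C / l) * weakX X U"
proof -
  obtain K where K: "quasi_const X K"
    using bqb_quasi_const[OF X] .
  then have K1: "1 \<le> K" by (simp add: quasi_const_def)
  \<comment> \<open>Solves \<open>B powr (1 - r) = 2 * K\<close>, the ratio for the upper part;
    being above 1, it also satisfies \<open>2 * K \<le> B\<close>, as the lower part
    requires.\<close>
  define B where "B = (2 * K) powr (1 / (1 - r))"
  have B: "2 * K \<le> B powr (1 - r)"
    using K1 r by (simp add: B_def powr_powr)
  have B1: "1 < B"
    unfolding B_def using K1 r by (intro gr_one_powr) auto
  have "B powr (1 - r) \<le> B powr 1"
    using B1 r by (intro powr_mono) auto
  with B B1 have B': "2 * K \<le> B" by simp
  have sr: "s < pm"
  proof -
    have "s \<le> 2 * s / r" using s r by (simp add: field_simps)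
    then show ?thesis using s by simp
  qed
  obtain C1 :: real where C1: "0 \<le> C1" "\<And>fs. (\<And>j. fs j \<in> borel_measurable lebesgue) \<Longrightarrow>
      X (\<lambda>x. epowr (\<Sum>j::nat. epowr (HLmax (fs j) x) (1 / s)) (r / 2))
        \<le> ennreal C1 * X (\<lambda>x. epowr (\<Sum>j. epowr (fs j x) (1 / s)) (r / 2))"
    using FS_condition_power[OF FS s(1,2), of "r / 2"] r s by (auto simp: mult.commute)
  obtain C2 :: real where C2: "0 \<le> C2" "\<And>fs. (\<And>j. fs j \<in> borel_measurable lebesgue) \<Longrightarrow>
      X (\<lambda>x. epowr (\<Sum>j::nat. epowr (HLmax (fs j) x) (1 / s)) 1)
        \<le> ennreal C2 * X (\<lambda>x. epowr (\<Sum>j. epowr (fs j x) (1 / s)) 1)"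
    using FS_condition_power[OF FS s(1,2), of 1] sr by auto
  define D1 where "D1 = C1 * (2 * K * B powr r)"
  define D2 where "D2 = C2 * (2 * K * B ^ 3)"
  have D: "0 \<le> D1" "0 \<le> D2"
    using C1 C2 K1 B1 by (auto simp: D1_def D2_def)
  define C where "C = K * (D1 + D2) + 1"
  have C: "0 < C" using D K1 by (auto simp: C_def intro!: add_nonneg_pos mult_nonneg_nonneg)
  show ?thesis
  proof (rule that[OF C])
    fix u :: "nat \<Rightarrow> 'a \<Rightarrow> ennreal" and U :: "'a \<Rightarrow> ennreal" and l :: real
    assume u [measurable]: "\<And>j. u j \<in> borel_measurable lebesgue"
      and U: "U = (\<lambda>x. epowr (\<Sum>j::nat. u j x) (1 / 2))" and l: "0 < l"
    have Um [measurable]: "U \<in> borel_measurable lebesgue"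
      unfolding U by measurable
    define O1 where "O1 = {x. U x > ennreal l}"
    define O2 where "O2 = {x. \<not> U x > ennreal l}"
    have O1_meas [measurable]: "O1 \<in> sets lebesgue"
      unfolding O1_def by (rule superlevel_sets_lebesgue[OF Um])
    have "O2 = - O1"
      by (auto simp: O1_def O2_def)
    then have O2_meas [measurable]: "O2 \<in> sets lebesgue"
      using sets.compl_sets[OF O1_meas] by (simp add: Compl_eq_Diff_UNIV)
    \<comment> \<open>Cutting after taking the power \<open>s\<close> is harmless, since indicators
      pass through powers: the inner sum in the Fefferman--Stein bound becomes
      \<open>(U x)\<^sup>2\<close> cut to \<open>A\<close>. The outer exponents \<open>r / 2\<close>
      and 1 then give the functions of the two layer estimates.\<close>
    define f where "f A j y = epowr (u j y) s * indicator A y" for A j y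
    define T where "T A x = (\<Sum>j. epowr (HLmax (f A j) x) (1 / s))" for A x
    have f_meas [measurable]: "f A j \<in> borel_measurable lebesgue" if [measurable]: "A \<in> sets lebesgue" for A j
      unfolding f_def by measurable
    have T_meas [measurable]: "T A \<in> borel_measurable lebesgue" for A
      unfolding T_def by measurable
    have sum_f: "(\<Sum>j. epowr (f A j x) (1 / s)) = (\<Sum>j. u j x) * indicator A x" for A x
      using s by (simp add: f_def epowr_indicator epowr_epowr)
    have X1: "X (\<lambda>x. epowr (T O1 x) (r / 2)) \<le> ennreal (D1 * l powr (r - 1)) * weakX X U"
    proof -
      have "X (\<lambda>x. epowr (T O1 x) (r / 2)) \<le> ennreal C1 * X (\<lambda>x. epowr (\<Sum>j. epowr (f O1 j x) (1 / s)) (r / 2))"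
        unfolding T_def by (intro C1 f_meas O1_meas O2_meas)
      also have "(\<lambda>x. epowr (\<Sum>j. epowr (f O1 j x) (1 / s)) (r / 2)) = (\<lambda>x. epowr (U x) r * indicator O1 x)"
        unfolding sum_f by (simp add: U epowr_indicator epowr_epowr)
      also have "ennreal C1 * X \<dots> \<le> ennreal C1 * (ennreal (2 * K * B powr r * l powr (r - 1)) * weakX X U)"
        unfolding O1_def by (intro mult_left_mono bqb_upper_part_le[OF X K Um r B1 B l]) simp
      also have "\<dots> = ennreal (D1 * l powr (r - 1)) * weakX X U"
        using C1 K1 by (simp add: D1_def mult_ac ennreal_mult)
      finally show ?thesis .
    qed
    have X2: "X (T O2) \<le> ennreal (D2 * l) * weakX X U"
    proof -
      have "X (\<lambda>x. epowr (T O2 x) 1) \<le> ennreal C2 * X (\<lambda>x. epowr (\<Sum>j. epowr (f O2 j x) (1 / s)) 1)"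
        unfolding T_def by (intro C2 f_meas O1_meas O2_meas)
      also have "(\<lambda>x. epowr (\<Sum>j. epowr (f O2 j x) (1 / s)) 1) = (\<lambda>x. epowr (U x) 2 * indicator O2 x)"
        unfolding sum_f by (simp add: U epowr_epowr)
      also have "ennreal C2 * X \<dots> \<le> ennreal C2 * (ennreal (2 * K * B ^ 3 * l) * weakX X U)"
        unfolding O2_def by (intro mult_left_mono bqb_lower_part_le[OF X K Um B1 B' l]) simp
      also have "\<dots> = ennreal (D2 * l) * weakX X U"
        using C2 K1 B1 l by (simp add: D2_def mult_ac ennreal_mult)
      finally show ?thesis by simp
    qed
    let ?S = "\<lambda>x. \<Sum>j. epowr (HLmax (\<lambda>y. epowr (u j y) s) x) (1 / s)"
    let ?E = "{x. ?S x > ennreal (2 powr (1 / s) * (2 * l\<^sup>2))}"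
    \<comment> \<open>Sublinearity of the maximal operator, then the power \<open>1 / s\<close>,
      whose loss \<open>2 powr (1 / s)\<close> is built into the threshold.\<close>
    have split: "?S x \<le> ennreal (2 powr (1 / s)) * (T O1 x + T O2 x)" for x
    proof -
      have "epowr (HLmax (\<lambda>y. epowr (u j y) s) x) (1 / s)
          \<le> ennreal (2 powr (1 / s)) * (epowr (HLmax (f O1 j) x) (1 / s) + epowr (HLmax (f O2 j) x) (1 / s))" for j
      proof -
        have "(\<lambda>y. epowr (u j y) s) = (\<lambda>y. f O1 j y + f O2 j y)"
          by (auto simp: f_def O1_def O2_def split: split_indicator)
        then have "HLmax (\<lambda>y. epowr (u j y) s) x \<le> HLmax (f O1 j) x + HLmax (f O2 j) x"
          by (simp add: HLmax_add_le)
        then have "epowr (HLmax (\<lambda>y. epowr (u j y) s) x) (1 / s) \<le> epowr (HLmax (f O1 j) x + HLmax (f O2 j) x) (1 / s)"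
          using s by (intro epowr_mono) auto
        also have "\<dots> \<le> ennreal (2 powr (1 / s)) * (epowr (HLmax (f O1 j) x) (1 / s) + epowr (HLmax (f O2 j) x) (1 / s))"
          using s by (intro epowr_add_le_two_powr) auto
        finally show ?thesis .
      qed
      then have "?S x \<le> (\<Sum>j. ennreal (2 powr (1 / s)) * (epowr (HLmax (f O1 j) x) (1 / s) + epowr (HLmax (f O2 j) x) (1 / s)))"
        by (intro suminf_le) auto
      then show ?thesis
        by (simp add: T_def suminf_add)
    qed
    \<comment> \<open>The remaining factor 2 in the threshold forces one of the two sums above
      \<open>l\<^sup>2\<close>. The Chebyshev weights meet the bounds of order
      \<open>l powr (r - 1)\<close> and \<open>l\<close>, so both parts come out of order
      \<open>1 / l\<close>.\<close>
    have ind: "indicator ?E x \<le> ennreal (l powr - r) * epowr (T O1 x) (r / 2) + ennreal (l powr - 2) * T O2 x" for x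
    proof (cases "x \<in> ?E")
      case True
      have "T O1 x > ennreal (l\<^sup>2) \<or> T O2 x > ennreal (l\<^sup>2)"
      proof (rule ccontr)
        assume "\<not> ?thesis"
        then have "T O1 x + T O2 x \<le> ennreal (2 * l\<^sup>2)"
          using add_mono[of "T O1 x" "ennreal (l\<^sup>2)" "T O2 x" "ennreal (l\<^sup>2)"] by (simp add: not_less flip: ennreal_plus)
        then have "ennreal (2 powr (1 / s)) * (T O1 x + T O2 x) \<le> ennreal (2 powr (1 / s) * (2 * l\<^sup>2))"
          by (simp add: ennreal_mult mult_left_mono)
        with split[of x] True show False by auto
      qed
      then have "1 \<le> (indicator {x. T O1 x > ennreal (l\<^sup>2)} x + indicator {x. T O2 x > ennreal (l\<^sup>2)} x :: ennreal)"
        by auto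
      also have "\<dots> \<le> ennreal (l powr (- (2 * (r / 2)))) * epowr (T O1 x) (r / 2) + ennreal (l powr (- (2 * 1))) * epowr (T O2 x) 1"
        using l r by (intro add_mono indicator_superlevel_le_epowr) auto
      finally show ?thesis using True by simp
    qed simp
    have S_meas: "?S \<in> borel_measurable lebesgue"
      by measurable
    have R_meas: "(\<lambda>x. ennreal (l powr - r) * epowr (T O1 x) (r / 2) + ennreal (l powr - 2) * T O2 x) \<in> borel_measurable lebesgue"
      by measurable
    have "X (indicator ?E) \<le> X (\<lambda>x. ennreal (l powr - r) * epowr (T O1 x) (r / 2) + ennreal (l powr - 2) * T O2 x)"
      by (intro bqb_mono[OF X R_meas _ ind] borel_measurable_indicator superlevel_sets_lebesgue S_meas)
    also have "\<dots> \<le> ennreal K * (X (\<lambda>x. ennreal (l powr - r) * epowr (T O1 x) (r / 2)) + X (\<lambda>x. ennreal (l powr - 2) * T O2 x))"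
      using K by (simp add: quasi_const_def)
    also have "\<dots> = ennreal K * (ennreal (l powr - r) * X (\<lambda>x. epowr (T O1 x) (r / 2)) + ennreal (l powr - 2) * X (T O2))"
      by (simp add: bqb_cmult[OF X])
    also have "\<dots> \<le> ennreal K * (ennreal (l powr - r) * (ennreal (D1 * l powr (r - 1)) * weakX X U)
        + ennreal (l powr - 2) * (ennreal (D2 * l) * weakX X U))"
      by (intro mult_left_mono add_mono X1 X2) auto
    also have "\<dots> = ennreal (K * (D1 + D2) / l) * weakX X U"
    proof -
      have *: "l powr - r * (D1 * l powr (r - 1)) = D1 / l" "l powr - 2 * (D2 * l) = D2 / l"
        using l by (auto simp: powr_diff powr_minus field_simps power2_eq_square)
      have "ennreal (l powr - r) * (ennreal (D1 * l powr (r - 1)) * weakX X U) = ennreal (D1 / l) * weakX X U"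
        "ennreal (l powr - 2) * (ennreal (D2 * l) * weakX X U) = ennreal (D2 / l) * weakX X U"
        unfolding *[symmetric] using D l by (simp_all add: ennreal_mult mult.assoc)
      then show ?thesis
        using D l K1 by (simp add: add_divide_distrib ennreal_mult mult.assoc flip: distrib_right times_divide_eq_right)
    qed
    also have "\<dots> \<le> ennreal (C / l) * weakX X U"
      using l by (intro mult_right_mono ennreal_leI divide_right_mono) (auto simp: C_def)
    finally show "X (indicator ?E) \<le> ennreal (C / l) * weakX X U" .
  qed
qed

section \<open>Change of aperture in the weak space\<close>

theorem theorem3p23:
  fixes X :: "('a::euclidean_space \<Rightarrow> ennreal) \<Rightarrow> ennreal"
    and pm r0 p0 q r :: real
  assumes X: "ball_quasi_banach_function_space X"
    and pm: "0 < pm" and FS: "FS_condition X pm"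
    and BBF: "\<And>s. 0 < s \<Longrightarrow> s < min pm 1 \<Longrightarrow> ball_banach_function_space (Xpow X (1 / s))"
    and r0: "0 < r0" "r0 < min pm 1"
    and p0: "r0 < p0"
    and Mbdd: "\<exists>C::real. \<forall>F. F \<in> borel_measurable lebesgue \<longrightarrow>
                 assoc (Xpow X (1 / r0)) F < \<infinity> \<longrightarrow>
                 assoc (Xpow X (1 / r0)) (HLmax_pow (conj_exp (p0 / r0)) F)
                   \<le> ennreal C * assoc (Xpow X (1 / r0)) F"
    and q: "max 1 p0 < q" "q \<le> p0 / r0"
    and r: "0 < r" "r < 1"
  shows "\<exists>C::real. C > 0 \<and> (\<forall>\<alpha>::real. \<forall>F::'a \<times> real \<Rightarrow> real. 1 \<le> \<alpha> \<longrightarrow>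
           F \<in> borel_measurable lebesgue \<longrightarrow> weakX X (conical_A 1 F) < \<infinity> \<longrightarrow>
           weakX X (conical_A \<alpha> F)
             \<le> ennreal (C * (max (\<alpha> powr ((1/2 - 1/q) * real DIM('a))) 1) powr (q / p0)
                         * \<alpha> powr (real DIM('a) / (r0 * r)))
               * weakX X (conical_A 1 F))"
proof -
  \<comment> \<open>With this choice \<open>2 * s / r\<close> is \<open>r0\<close>, which is below
    \<open>pm\<close>, and the square root of \<open>\<alpha> powr (n / s)\<close> is
    \<open>\<alpha> powr (n / (r0 * r))\<close>.\<close>
  define s where "s = r0 * r / 2"
  have "r0 * r < 1 * 1"
    using r0 r by (intro mult_strict_mono) auto
  then have s: "0 < s" "s < 1" "2 * s / r < pm"
    using r0 r by (auto simp: s_def)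
  obtain C where C: "0 < C" "\<And>u U l. (\<And>j. u j \<in> borel_measurable lebesgue) \<Longrightarrow>
      U = (\<lambda>x. epowr (\<Sum>j::nat. u j x) (1 / 2)) \<Longrightarrow> 0 < l \<Longrightarrow>
      X (indicator {x. (\<Sum>j. epowr (HLmax (\<lambda>y. epowr (u j y) s) x) (1 / s)) > ennreal (2 powr (1 / s) * (2 * l\<^sup>2))})
        \<le> ennreal (C / l) * weakX X U"
    using weak_maximal_sum_le[OF X FS r s] by blast
  let ?n = "real DIM('a)"
  \<comment> \<open>Under the root stand the constants of the threshold in the weak bound and the
    factor \<open>30\<close> of the aperture estimate raised to \<open>?n / s\<close>.\<close>
  define L where "L = sqrt (2 powr (1 / s) * 2 * 30 powr (?n / s))"
  have L: "0 < L" by (simp add: L_def)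
  show ?thesis
  proof (intro exI[of _ "C * L"] conjI allI impI)
    show "0 < C * L" using C L by simp
    fix \<alpha> :: real and F :: "'a \<times> real \<Rightarrow> real"
    assume \<alpha>: "1 \<le> \<alpha>" and F [measurable]: "F \<in> borel_measurable lebesgue"
    define \<mu> where "\<mu> = density lebesgue (\<lambda>z::'a \<times> real. ennreal ((F z)\<^sup>2 / snd z ^ (DIM('a) + 1)))"
    have sets [simp]: "sets \<mu> = sets lebesgue" by (simp add: \<mu>_def)
    have A: "conical_A a F x = epowr (emeasure \<mu> (cone_at a x)) (1 / 2)" for a x
      unfolding \<mu>_def by (rule conical_A_eq) fact
    define u where "u j x = emeasure \<mu> (cone_at 1 x \<inter> slice (dyadic j))" for j x
    have u: "u j \<in> borel_measurable lebesgue" for j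
      unfolding u_def by (intro emeasure_cone_measurable) simp_all
    have A1: "conical_A 1 F = (\<lambda>x. epowr (\<Sum>j. u j x) (1 / 2))"
      unfolding A u_def by (subst emeasure_cone_eq_suminf[OF sets]) simp
    define S where "S x = (\<Sum>j. epowr (HLmax (\<lambda>y. epowr (u j y) s) x) (1 / s))" for x
    define N where "N = \<alpha> powr (?n / (r0 * r))"
    have N: "0 < N" using \<alpha> by (simp add: N_def)
    have N2: "N\<^sup>2 = \<alpha> powr (?n / s)"
      using \<alpha> by (simp add: N_def s_def powr_power mult.commute)
    have "weakX X (conical_A \<alpha> F) \<le> ennreal (C * L * N) * weakX X (conical_A 1 F)"
      unfolding weakX_def[of X "conical_A \<alpha> F"]
    proof (intro SUP_least)
      fix b :: real assume "b \<in> {0<..}"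
      then have b: "0 < b" by simp
      \<comment> \<open>Chosen so that the threshold at \<open>l\<close>, times the aperture
        constant, is exactly \<open>b\<^sup>2\<close>; the bound of order \<open>1 / l\<close> then
        yields the factor \<open>L * N\<close> after multiplication by \<open>b\<close>.\<close>
      define l where "l = b / (L * N)"
      have l: "0 < l" using b L N by (simp add: l_def)
      have sub: "{x. conical_A \<alpha> F x > ennreal b} \<subseteq> {x. S x > ennreal (2 powr (1 / s) * (2 * l\<^sup>2))}"
      proof (intro subsetI CollectI, rule ccontr)
        fix x assume x: "x \<in> {x. conical_A \<alpha> F x > ennreal b}"
          and "\<not> S x > ennreal (2 powr (1 / s) * (2 * l\<^sup>2))"
        then have Sx: "S x \<le> ennreal (2 powr (1 / s) * (2 * l\<^sup>2))" by simp
        have "emeasure \<mu> (cone_at \<alpha> x) \<le> ennreal ((30 * \<alpha>) powr (?n / s)) * S x"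
          unfolding S_def u_def using s \<alpha> by (intro emeasure_cone_le) auto
        also have "\<dots> \<le> ennreal ((30 * \<alpha>) powr (?n / s)) * ennreal (2 powr (1 / s) * (2 * l\<^sup>2))"
          by (intro mult_left_mono Sx) simp
        also have "\<dots> = ennreal ((L * N * l)\<^sup>2)"
        proof -
          have "L\<^sup>2 = 2 powr (1 / s) * 2 * 30 powr (?n / s)"
            by (simp add: L_def)
          then show ?thesis
            using \<alpha> by (simp add: power_mult_distrib N2 powr_mult mult_ac flip: ennreal_mult)
        qed
        also have "L * N * l = b"
          using L N by (simp add: l_def)
        finally have "epowr (emeasure \<mu> (cone_at \<alpha> x)) (1 / 2) \<le> epowr (ennreal (b\<^sup>2)) (1 / 2)"
          by (intro epowr_mono) auto
        also have "\<dots> = ennreal b"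
          using b by (simp add: epowr_ennreal powr_half_sqrt)
        finally show False
          using x by (simp add: A)
      qed
      have UNIV_meas: "UNIV \<in> sets (lebesgue :: ('a \<times> real) measure)"
        by simp
      have S_meas: "S \<in> borel_measurable lebesgue"
        unfolding S_def by measurable
      have A_meas: "conical_A \<alpha> F \<in> borel_measurable lebesgue"
        unfolding A using emeasure_cone_measurable[OF sets UNIV_meas, of \<alpha>]
        by (intro borel_measurable_epowr) simp
      have "X (indicator {x. conical_A \<alpha> F x > ennreal b}) \<le> X (indicator {x. S x > ennreal (2 powr (1 / s) * (2 * l\<^sup>2))})"
        using sub by (intro bqb_mono[OF X] borel_measurable_indicator superlevel_sets_lebesgue
            S_meas A_meas) (simp add: indicator_def subset_iff)
      also have "\<dots> \<le> ennreal (C / l) * weakX X (conical_A 1 F)"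
        unfolding S_def by (rule C(2)[OF u A1 l])
      finally have "ennreal b * X (indicator {x. conical_A \<alpha> F x > ennreal b})
          \<le> ennreal b * (ennreal (C / l) * weakX X (conical_A 1 F))"
        by (rule mult_left_mono) simp
      also have "\<dots> = ennreal (C * L * N) * weakX X (conical_A 1 F)"
      proof -
        have "b * (C / l) = C * L * N"
          using b L N by (simp add: l_def)
        then show ?thesis
          using b C l by (simp flip: mult.assoc ennreal_mult)
      qed
      finally show "ennreal b * X (indicator {x. conical_A \<alpha> F x > ennreal b})
          \<le> ennreal (C * L * N) * weakX X (conical_A 1 F)" .
    qed
    also have "\<dots> \<le> ennreal (C * L * max (\<alpha> powr ((1/2 - 1/q) * ?n)) 1 powr (q / p0) * N) * weakX X (conical_A 1 F)"
    proof (intro mult_right_mono ennreal_leI)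
      have "1 \<le> max (\<alpha> powr ((1/2 - 1/q) * ?n)) 1 powr (q / p0)"
        using q p0 r0 by (intro ge_one_powr_ge_zero) auto
      then show "C * L \<le> C * L * max (\<alpha> powr ((1/2 - 1/q) * ?n)) 1 powr (q / p0)"
        using C L by simp
    qed (use N in auto)
    finally show "weakX X (conical_A \<alpha> F)
        \<le> ennreal (C * L * max (\<alpha> powr ((1/2 - 1/q) * ?n)) 1 powr (q / p0) * \<alpha> powr (?n / (r0 * r)))
          * weakX X (conical_A 1 F)"
      unfolding N_def .
  qed
qed

end
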